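(* Let $G$ and $H$ be finite groups and let $f : G \to H$ be a function. Then $f$ is strongly inverse preserving if and only if $f$ is a sandwich morphism.
   Context: For a function $f : G \to H$ between groups (not assumed to be a homomorphism) and $a \in G$, the conjugate of $f$ by $a$ is the function $f^a : G \to H$ given by $f^a(x) = f(a)^{-1} f(ax)$. A function $g : G \to H$ is inverse preserving if $g(x^{-1})^{-1} = g(x)$ for all $x \in G$ (equivalently $g(x^{-1}) = g(x)^{-1}$ for all $x$). The function $f$ is strongly inverse preserving if $f^a$ is inverse preserving for every $a \in G$. The function $f$ is a sandwich morphism if $f(ab^{-1}a) = f(a) f(b)^{-1} f(a)$ for all $a, b \in G$. In all these formulas juxtaposition is the group operation. *)

theory Defs
  imports "HOL-Algebra.Group"
begin

(* The definitions are meant for groups G, H and f in carrier G -> carrier H, not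
   necessarily a homomorphism; they only depend on the values of f on carrier G. *)

definition conjugate_fun ::
  "('a, 'c) monoid_scheme \<Rightarrow> ('b, 'd) monoid_scheme \<Rightarrow> ('a \<Rightarrow> 'b) \<Rightarrow> 'a \<Rightarrow> 'a \<Rightarrow> 'b" where
  "conjugate_fun G H f a = (\<lambda>x. inv\<^bsub>H\<^esub> (f a) \<otimes>\<^bsub>H\<^esub> f (a \<otimes>\<^bsub>G\<^esub> x))"

definition inverse_preserving ::
  "('a, 'c) monoid_scheme \<Rightarrow> ('b, 'd) monoid_scheme \<Rightarrow> ('a \<Rightarrow> 'b) \<Rightarrow> bool" where
  "inverse_preserving G H g \<longleftrightarrow>
     (\<forall>x\<in>carrier G. inv\<^bsub>H\<^esub> (g (inv\<^bsub>G\<^esub> x)) = g x)"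

definition strongly_inverse_preserving ::
  "('a, 'c) monoid_scheme \<Rightarrow> ('b, 'd) monoid_scheme \<Rightarrow> ('a \<Rightarrow> 'b) \<Rightarrow> bool" where
  "strongly_inverse_preserving G H f \<longleftrightarrow>
     (\<forall>a\<in>carrier G. inverse_preserving G H (conjugate_fun G H f a))"

definition sandwich_morphism ::
  "('a, 'c) monoid_scheme \<Rightarrow> ('b, 'd) monoid_scheme \<Rightarrow> ('a \<Rightarrow> 'b) \<Rightarrow> bool" where
  "sandwich_morphism G H f \<longleftrightarrow>
     (\<forall>a\<in>carrier G. \<forall>b\<in>carrier G.
        f (a \<otimes>\<^bsub>G\<^esub> inv\<^bsub>G\<^esub> b \<otimes>\<^bsub>G\<^esub> a) =
        f a \<otimes>\<^bsub>H\<^esub> inv\<^bsub>H\<^esub> (f b) \<otimes>\<^bsub>H\<^esub> f a)"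

end

theory Submission
  imports Defs
begin

text \<open>
  Fix \<open>a\<close>. As \<open>(f(a)\<^sup>-\<^sup>1 f(a x\<^sup>-\<^sup>1))\<^sup>-\<^sup>1 = f(a x\<^sup>-\<^sup>1)\<^sup>-\<^sup>1 f(a)\<close>, multiplying the
  inverse-preserving equation of \<open>f\<^sup>a\<close> at \<open>x\<close> on the left by \<open>f(a)\<close> turns it into
  \<open>f(a x) = f(a) f(a x\<^sup>-\<^sup>1)\<^sup>-\<^sup>1 f(a)\<close>. This is the sandwich equation for the pair \<open>(a, b)\<close>
  with \<open>b = a x\<^sup>-\<^sup>1\<close>, because then \<open>x = b\<^sup>-\<^sup>1 a\<close> and \<open>a x = a b\<^sup>-\<^sup>1 a\<close>. Since
  \<open>b \<mapsto> b\<^sup>-\<^sup>1 a\<close> is a bijection of the group, quantifying over \<open>x\<close> is the same as quantifying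
  over \<open>b\<close>, so the two families of equations coincide.
\<close>

text \<open>
  The case \<open>u = f(a)\<close>, \<open>v = f(a x\<^sup>-\<^sup>1)\<close>, \<open>w = f(a x)\<close> is the inverse-preserving equation
  of a conjugate, solved for its right-most value.
\<close>

lemma (in group) inv_inv_mult_eq_iff_eq_sandwich:
  assumes "u \<in> carrier G" "v \<in> carrier G" "w \<in> carrier G"
  shows "inv (inv u \<otimes> v) = inv u \<otimes> w \<longleftrightarrow> w = u \<otimes> inv v \<otimes> u"
proof -
  have "inv (inv u \<otimes> v) = inv v \<otimes> u"
    using assms by (simp add: inv_mult_group)
  then show ?thesis
    using assms inv_solve_left[of "inv v \<otimes> u" u w] by (simp add: m_assoc)
qed

lemma (in group) bij_betw_inv_mult_right:
  assumes "a \<in> carrier G"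
  shows "bij_betw (\<lambda>b. inv b \<otimes> a) (carrier G) (carrier G)"
  by (rule bij_betw_byWitness[where f' = "\<lambda>x. a \<otimes> inv x"])
     (use assms in \<open>auto simp: inv_mult_group m_assoc [symmetric], simp_all add: m_assoc\<close>)

lemma inverse_preserving_conjugate_fun_iff:
  assumes "group G" "group H" "f \<in> carrier G \<rightarrow> carrier H" and a: "a \<in> carrier G"
  shows "inverse_preserving G H (conjugate_fun G H f a) \<longleftrightarrow>
    (\<forall>b\<in>carrier G. f (a \<otimes>\<^bsub>G\<^esub> inv\<^bsub>G\<^esub> b \<otimes>\<^bsub>G\<^esub> a) =
        f a \<otimes>\<^bsub>H\<^esub> inv\<^bsub>H\<^esub> (f b) \<otimes>\<^bsub>H\<^esub> f a)"
proof -
  interpret G: group G by fact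
  interpret H: group H by fact
  have f: "f x \<in> carrier H" if "x \<in> carrier G" for x
    using assms(3) that by blast
  have "inverse_preserving G H (conjugate_fun G H f a) \<longleftrightarrow>
      (\<forall>x\<in>carrier G. f (a \<otimes>\<^bsub>G\<^esub> x) =
          f a \<otimes>\<^bsub>H\<^esub> inv\<^bsub>H\<^esub> (f (a \<otimes>\<^bsub>G\<^esub> inv\<^bsub>G\<^esub> x)) \<otimes>\<^bsub>H\<^esub> f a)"
    unfolding inverse_preserving_def conjugate_fun_def
    by (intro ball_cong refl H.inv_inv_mult_eq_iff_eq_sandwich)
       (simp_all add: a f)
  also have "\<dots> \<longleftrightarrow>
      (\<forall>b\<in>carrier G. f (a \<otimes>\<^bsub>G\<^esub> (inv\<^bsub>G\<^esub> b \<otimes>\<^bsub>G\<^esub> a)) =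
          f a \<otimes>\<^bsub>H\<^esub> inv\<^bsub>H\<^esub> (f (a \<otimes>\<^bsub>G\<^esub> inv\<^bsub>G\<^esub> (inv\<^bsub>G\<^esub> b \<otimes>\<^bsub>G\<^esub> a))) \<otimes>\<^bsub>H\<^esub> f a)"
    by (rule bij_betw_ball[OF G.bij_betw_inv_mult_right[OF a]])
  also have "\<dots> \<longleftrightarrow>
      (\<forall>b\<in>carrier G. f (a \<otimes>\<^bsub>G\<^esub> inv\<^bsub>G\<^esub> b \<otimes>\<^bsub>G\<^esub> a) =
          f a \<otimes>\<^bsub>H\<^esub> inv\<^bsub>H\<^esub> (f b) \<otimes>\<^bsub>H\<^esub> f a)"
  proof (intro ball_cong refl)
    fix b assume b: "b \<in> carrier G"
    have "a \<otimes>\<^bsub>G\<^esub> inv\<^bsub>G\<^esub> (inv\<^bsub>G\<^esub> b \<otimes>\<^bsub>G\<^esub> a) = b"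
      using a b by (simp add: G.inv_mult_group G.m_assoc [symmetric])
    then show "f (a \<otimes>\<^bsub>G\<^esub> (inv\<^bsub>G\<^esub> b \<otimes>\<^bsub>G\<^esub> a)) =
          f a \<otimes>\<^bsub>H\<^esub> inv\<^bsub>H\<^esub> (f (a \<otimes>\<^bsub>G\<^esub> inv\<^bsub>G\<^esub> (inv\<^bsub>G\<^esub> b \<otimes>\<^bsub>G\<^esub> a))) \<otimes>\<^bsub>H\<^esub> f a \<longleftrightarrow>
        f (a \<otimes>\<^bsub>G\<^esub> inv\<^bsub>G\<^esub> b \<otimes>\<^bsub>G\<^esub> a) =
          f a \<otimes>\<^bsub>H\<^esub> inv\<^bsub>H\<^esub> (f b) \<otimes>\<^bsub>H\<^esub> f a"
      using a b by (simp add: G.m_assoc)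
  qed
  finally show ?thesis .
qed

theorem proposition3p1:
  fixes G :: "('a, 'c) monoid_scheme" and H :: "('b, 'd) monoid_scheme"
    and f :: "'a \<Rightarrow> 'b"
  assumes "group G" and "finite (carrier G)"
    and "group H" and "finite (carrier H)"
    and "f \<in> carrier G \<rightarrow> carrier H"
  shows "strongly_inverse_preserving G H f \<longleftrightarrow> sandwich_morphism G H f"
  unfolding strongly_inverse_preserving_def sandwich_morphism_def
  by (intro ball_cong refl inverse_preserving_conjugate_fun_iff assms)

end
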